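(* Let $G$ be a topological rough group with rough identity element $e$. If $e\in G$ and $U$ is an open neighborhood of $e$ in $\overline{G}$, then there exists an open set $V$ in $G$ with $e\in V$ such that $V=V^{-1}$ and $V^2\subset U$.
   Context: An approximation space $(X,R)$ is a non-empty set $X$ with an equivalence relation $R$; for $A\subset X$ the upper approximation is $\overline{A}=\{x\in X:[x]_R\cap A\neq\emptyset\}$, where $[x]_R$ is the equivalence class of $x$. Let $X$ carry a binary operation, written $xy$. A subset $G\subset X$ is a rough group if: (1) $xy\in\overline{G}$ for all $x,y\in G$; (2) $(xy)z=x(yz)$ for all $x,y,z\in\overline{G}$; (3) there is $e\in\overline{G}$ (the rough identity element) with $ex=xe=x$ for all $x\in\overline{G}$; (4) for every $x\in G$ there is $y\in G$ with $xy=yx=e$ (written $y=x^{-1}$). A topological rough group is a rough group $G$ together with a topology $\tau$ on $\overline{G}$ such that, with $\tau_G$ the subspace topology on $G$, the multiplication $G\times G\to\overline{G}$, $(x,y)\mapsto xy$, is continuous (product topology of $\tau_G$ on $G\times G$, $\tau$ on $\overline{G}$) and the inverse mapping $G\to G$, $x\mapsto x^{-1}$, is continuous for $\tau_G$. For $V\subset G$: $V^{-1}=\{v^{-1}:v\in V\}$ and $V^2=\{vw:v,w\in V\}$. *)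

theory Defs
  imports "HOL-Analysis.Analysis"
begin

locale approximation_space =
  fixes X :: "'a set" and R :: "('a \<times> 'a) set"
  assumes nonempty: "X \<noteq> {}"
    and equivalence: "equiv X R"

definition upper_approx :: "'a set \<Rightarrow> ('a \<times> 'a) set \<Rightarrow> 'a set \<Rightarrow> 'a set" where
  "upper_approx X R A = {x \<in> X. R `` {x} \<inter> A \<noteq> {}}"

text \<open>The rough identity element is a parameter, as it occurs in the axiom on inverses;
  it is determined by the other data, see \<open>rough_identity_unique\<close> below.\<close>

locale rough_group = approximation_space X R
  for X :: "'a set" and R :: "('a \<times> 'a) set" +
  fixes mul :: "'a \<Rightarrow> 'a \<Rightarrow> 'a" (infixl "\<cdot>" 70)
    and G :: "'a set"
    and e :: 'a
  assumes op_closed: "\<lbrakk>x \<in> X; y \<in> X\<rbrakk> \<Longrightarrow> x \<cdot> y \<in> X"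
    and subset: "G \<subseteq> X"
    and mult_in_upper: "\<lbrakk>x \<in> G; y \<in> G\<rbrakk> \<Longrightarrow> x \<cdot> y \<in> upper_approx X R G"
    and assoc: "\<lbrakk>x \<in> upper_approx X R G; y \<in> upper_approx X R G; z \<in> upper_approx X R G\<rbrakk>
                  \<Longrightarrow> (x \<cdot> y) \<cdot> z = x \<cdot> (y \<cdot> z)"
    and identity_in_upper: "e \<in> upper_approx X R G"
    and identity: "x \<in> upper_approx X R G \<Longrightarrow> e \<cdot> x = x \<and> x \<cdot> e = x"
    and inverse_exists: "x \<in> G \<Longrightarrow> \<exists>y\<in>G. x \<cdot> y = e \<and> y \<cdot> x = e"

definition rough_inverse :: "('a \<Rightarrow> 'a \<Rightarrow> 'a) \<Rightarrow> 'a set \<Rightarrow> 'a \<Rightarrow> 'a \<Rightarrow> 'a" where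
  "rough_inverse mul G e x = (THE y. y \<in> G \<and> mul x y = e \<and> mul y x = e)"

context rough_group
begin

lemma subset_upper: "G \<subseteq> upper_approx X R G"
  using subset equivalence by (auto simp: upper_approx_def equiv_def refl_on_def)

lemma rough_identity_unique:
  assumes "e' \<in> upper_approx X R G"
    and "\<And>x. x \<in> upper_approx X R G \<Longrightarrow> e' \<cdot> x = x \<and> x \<cdot> e' = x"
  shows "e' = e"
  using assms identity identity_in_upper by metis

lemma inverse_unique:
  assumes "x \<in> G"
  shows "\<exists>!y. y \<in> G \<and> x \<cdot> y = e \<and> y \<cdot> x = e"
proof (rule ex_ex1I)
  show "\<exists>y. y \<in> G \<and> x \<cdot> y = e \<and> y \<cdot> x = e"
    using inverse_exists[OF assms] by blast
next
  fix y z
  assume "y \<in> G \<and> x \<cdot> y = e \<and> y \<cdot> x = e" "z \<in> G \<and> x \<cdot> z = e \<and> z \<cdot> x = e"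
  then show "y = z"
    using assoc[of y x z] identity subset_upper assms by (metis subsetD)
qed

end

locale topological_rough_group = rough_group X R mul G e
  for X :: "'a set" and R :: "('a \<times> 'a) set" and mul :: "'a \<Rightarrow> 'a \<Rightarrow> 'a"
    and G :: "'a set" and e :: 'a +
  fixes \<tau> :: "'a topology"
  assumes topspace_upper: "topspace \<tau> = upper_approx X R G"
    and continuous_mult:
      "continuous_map (prod_topology (subtopology \<tau> G) (subtopology \<tau> G)) \<tau>
         (\<lambda>(x, y). mul x y)"
    and continuous_inverse:
      "continuous_map (subtopology \<tau> G) (subtopology \<tau> G) (rough_inverse mul G e)"

end

theory Submission imports Defs begin

text \<open>Continuity of the multiplication at \<open>(e, e)\<close> gives a neighbourhood \<open>W\<close> of \<open>e\<close> in \<open>G\<close> with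
  \<open>W W \<subseteq> U\<close>. Since inversion is a continuous involution of \<open>G\<close> fixing \<open>e\<close>, the intersection
  of \<open>W\<close> with its preimage under inversion is a symmetric open neighbourhood.\<close>

context rough_group
begin

lemma rough_inverse_props:
  assumes "x \<in> G"
  shows "rough_inverse mul G e x \<in> G" "x \<cdot> rough_inverse mul G e x = e"
    "rough_inverse mul G e x \<cdot> x = e"
  using theI'[OF inverse_unique[OF assms]] by (auto simp: rough_inverse_def)

lemma rough_inverse_eqI:
  assumes "x \<in> G" "y \<in> G" "x \<cdot> y = e" "y \<cdot> x = e"
  shows "rough_inverse mul G e x = y"
  using the1_equality[OF inverse_unique[OF assms(1)], of y] assms by (simp add: rough_inverse_def)

text \<open>The two equations characterising an inverse are symmetric in the element and its
  inverse, so \<open>x\<close> qualifies as the inverse of its own inverse.\<close>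

lemma rough_inverse_involution:
  assumes "x \<in> G"
  shows "rough_inverse mul G e (rough_inverse mul G e x) = x"
  by (rule rough_inverse_eqI) (simp_all add: assms rough_inverse_props)

text \<open>Follows from \<open>e\<close> being idempotent; \<open>e \<in> G\<close> is assumed
  because the axioms place \<open>e\<close> only in the upper approximation, while inverses are
  taken in \<open>G\<close>.\<close>

lemma rough_inverse_identity:
  assumes "e \<in> G"
  shows "rough_inverse mul G e e = e"
  using assms identity[OF identity_in_upper] by (intro rough_inverse_eqI) auto

end

context topological_rough_group
begin

lemma topspace_subtopology_G: "topspace (subtopology \<tau> G) = G"
  using subset_upper topspace_upper by auto

lemma square_neighbourhood:
  assumes "e \<in> G" "openin \<tau> U" "e \<in> U"
  obtains W where "openin (subtopology \<tau> G) W" "e \<in> W" "\<And>v w. v \<in> W \<Longrightarrow> w \<in> W \<Longrightarrow> mul v w \<in> U"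
proof -
  define P where "P = {p \<in> topspace (prod_topology (subtopology \<tau> G) (subtopology \<tau> G)).
    (case p of (x, y) \<Rightarrow> mul x y) \<in> U}"
  have op: "openin (prod_topology (subtopology \<tau> G) (subtopology \<tau> G)) P"
    unfolding P_def using openin_continuous_map_preimage[OF continuous_mult assms(2)] .
  have "mul e e = e"
    using identity identity_in_upper by blast
  \<comment> \<open>The default rule would turn the carrier into an intersection with
    \<open>topspace \<tau>\<close>; deleting it lets \<open>topspace_subtopology_G\<close> rewrite
    it to \<open>G\<close>.\<close>
  then have "(e, e) \<in> P"
    using assms by (simp add: P_def topspace_subtopology_G del: topspace_subtopology)
  then obtain A B where "openin (subtopology \<tau> G) A" "openin (subtopology \<tau> G) B"
    "e \<in> A" "e \<in> B" "A \<times> B \<subseteq> P"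
    using op[unfolded openin_prod_topology_alt, rule_format] by metis
  \<comment> \<open>The box \<open>A \<times> B\<close> may have different sides; intersecting them
    lets both factors range over one set.\<close>
  then show thesis
    by (intro that[of "A \<inter> B"]) (auto simp: P_def)
qed

lemma symmetric_neighbourhood:
  assumes "e \<in> G" "openin (subtopology \<tau> G) W" "e \<in> W"
  obtains V where "openin (subtopology \<tau> G) V" "e \<in> V" "V \<subseteq> W" "V = rough_inverse mul G e ` V"
proof -
  \<comment> \<open>The preimage is spelled with \<open>topspace\<close> to match
    \<open>openin_continuous_map_preimage\<close>.\<close>
  define V where "V = W \<inter> {x \<in> topspace (subtopology \<tau> G). rough_inverse mul G e x \<in> W}"
  have V: "V = {x \<in> G. x \<in> W \<and> rough_inverse mul G e x \<in> W}"
    unfolding V_def topspace_subtopology_G by auto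
  \<comment> \<open>By the involution law, inversion swaps the two membership conditions that define
    \<open>V\<close>.\<close>
  have closed: "rough_inverse mul G e x \<in> V" if "x \<in> V" for x
    using that rough_inverse_involution rough_inverse_props(1) unfolding V by auto
  \<comment> \<open>The witness is the inverse of \<open>x\<close>, which lies in \<open>V\<close>
    by \<open>closed\<close>.\<close>
  have "x \<in> rough_inverse mul G e ` V" if "x \<in> V" for x
  proof (rule image_eqI)
    show "x = rough_inverse mul G e (rough_inverse mul G e x)"
      using that rough_inverse_involution unfolding V by auto
  qed (rule closed[OF that])
  with closed have "V = rough_inverse mul G e ` V"
    by blast
  moreover have "openin (subtopology \<tau> G) V"
    unfolding V_def
    using openin_Int[OF assms(2) openin_continuous_map_preimage[OF continuous_inverse assms(2)]] .
  moreover have "e \<in> V"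
    using assms rough_inverse_identity V by simp
  moreover have "V \<subseteq> W"
    unfolding V by blast
  ultimately show thesis
    by (intro that)
qed

end

theorem proposition4p4:
  fixes X G U :: "'a set" and R :: "('a \<times> 'a) set"
    and mul :: "'a \<Rightarrow> 'a \<Rightarrow> 'a" and e :: 'a and \<tau> :: "'a topology"
  assumes "topological_rough_group X R mul G e \<tau>"
    and "e \<in> G"
    and "openin \<tau> U" and "e \<in> U"
  shows "\<exists>V. openin (subtopology \<tau> G) V \<and> e \<in> V
           \<and> V = rough_inverse mul G e ` V
           \<and> {mul v w | v w. v \<in> V \<and> w \<in> V} \<subseteq> U"
proof -
  interpret topological_rough_group X R mul G e \<tau>
    by (rule assms(1))
  obtain W where W: "openin (subtopology \<tau> G) W" "e \<in> W"
    "\<And>v w. v \<in> W \<Longrightarrow> w \<in> W \<Longrightarrow> mul v w \<in> U"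
    using square_neighbourhood[OF assms(2-4)] by blast
  obtain V where V: "openin (subtopology \<tau> G) V" "e \<in> V" "V \<subseteq> W"
    "V = rough_inverse mul G e ` V"
    by (rule symmetric_neighbourhood[OF assms(2) W(1,2)])
  have "{mul v w | v w. v \<in> V \<and> w \<in> V} \<subseteq> U"
    using V(3) W(3) by blast
  with V(1,2,4) show ?thesis
    by (intro exI conjI)
qed

end
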